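(* For every integer $n\ge 3$, $$PG(3n-1,2n-1)=p(n)-1$$ and $$PG(3n-2,2n-2)=PG(3n-3,2n-3)=p(n)-2.$$
   Context: A partition $\lambda=(\lambda_1\ge\cdots\ge\lambda_\ell)$ of $n$ is a finite nonincreasing sequence of positive integers with sum $n$; $\ell(\lambda)$ is its number of parts; $p(N)$ is the number of partitions of $N$. The hook length $h_{(i,j)}(\lambda)$ of a cell $(i,j)$ of the Ferrers diagram is the number of cells consisting of the cell itself, the cells to its right in its row and the cells below it in its column. A numerical set is a subset $S\subseteq\mathbb{N}_0$ containing $0$ with finite complement; a numerical semigroup is a numerical set closed under addition. For a partition $\lambda$ let $S_\lambda=\mathbb{N}_0\setminus\{h_{(i,1)}(\lambda):1\le i\le\ell(\lambda)\}$. $PG(n,g)$ is the number of partitions $\lambda$ of $n$ with exactly $g$ parts such that $S_\lambda$ is a numerical semigroup. *)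

theory Defs
  imports Main
begin

text \<open>Partitions are nonincreasing lists of positive integers; the part $\lambda_i$ is
  the list entry \<open>lam ! (i - 1)\<close>. Cells are indexed from \<open>(1, 1)\<close>.\<close>

definition is_partition :: "nat \<Rightarrow> nat list \<Rightarrow> bool" where
  "is_partition n lam \<longleftrightarrow> sorted_wrt (\<ge>) lam \<and> (\<forall>x\<in>set lam. 0 < x) \<and> sum_list lam = n"

definition num_partitions :: "nat \<Rightarrow> nat" where
  "num_partitions n = card {lam. is_partition n lam}"

definition ferrers :: "nat list \<Rightarrow> (nat \<times> nat) set" where
  "ferrers lam = {(i, j). 1 \<le> i \<and> i \<le> length lam \<and> 1 \<le> j \<and> j \<le> lam ! (i - 1)}"

definition hook :: "nat list \<Rightarrow> nat \<Rightarrow> nat \<Rightarrow> (nat \<times> nat) set" where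
  "hook lam i j = {(k, l) \<in> ferrers lam. (k = i \<and> l \<ge> j) \<or> (l = j \<and> k \<ge> i)}"

definition hook_length :: "nat list \<Rightarrow> nat \<Rightarrow> nat \<Rightarrow> nat" where
  "hook_length lam i j = card (hook lam i j)"

definition numerical_set :: "nat set \<Rightarrow> bool" where
  "numerical_set S \<longleftrightarrow> 0 \<in> S \<and> finite (- S)"

definition numerical_semigroup :: "nat set \<Rightarrow> bool" where
  "numerical_semigroup S \<longleftrightarrow> numerical_set S \<and> (\<forall>a\<in>S. \<forall>b\<in>S. a + b \<in> S)"

definition S_of :: "nat list \<Rightarrow> nat set" where
  "S_of lam = UNIV - {hook_length lam i 1 | i. 1 \<le> i \<and> i \<le> length lam}"

definition PG :: "nat \<Rightarrow> nat \<Rightarrow> nat" where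
  "PG n g = card {lam. is_partition n lam \<and> length lam = g \<and> numerical_semigroup (S_of lam)}"

lemma finite_partitions: "finite {lam. is_partition n lam}"
proof -
  have "length lam \<le> sum_list lam" if "\<forall>x\<in>set lam. 0 < x" for lam :: "nat list"
    using that by (induction lam) (auto simp: Suc_le_eq)
  then have "{lam. is_partition n lam} \<subseteq> {lam. set lam \<subseteq> {..n} \<and> length lam \<le> n}"
    by (auto simp: is_partition_def member_le_sum_list)
  then show ?thesis
    by (rule finite_subset) (simp add: finite_lists_length_le)
qed

end

theory Submission
  imports Defs
begin

text \<open>Removing the first column identifies the partitions of \<open>n + g\<close> with exactly \<open>g \<ge> n\<close> parts
  with the partitions \<open>\<nu>\<close> of \<open>n\<close>. If \<open>\<nu>\<close> has \<open>l\<close> parts, the smallest positive element of the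
  numerical set is \<open>m = g - l + 1\<close> and its largest gap is \<open>F = \<nu>\<^sub>1 + g\<close>, so the set is a semigroup
  as soon as \<open>2 m > F\<close>. As \<open>\<nu>\<^sub>1 + l \<le> n + 1\<close> with equality only for hook shapes, for
  \<open>g \<in> {2 n - 1, 2 n - 2, 2 n - 3}\<close> this fails only for \<open>\<nu> = (a, 1, \<dots>, 1)\<close> with \<open>a \<le> 2 n - g\<close>,
  and these at most three shapes are settled by looking at \<open>2 m\<close>.\<close>

section \<open>Hook lengths in the first column\<close>

text \<open>All parts are positive, so the column reaches the last row. The hook is then the
  disjoint union of row \<open>i\<close>, with \<open>lam ! (i - 1)\<close> cells, and a leg of
  \<open>length lam - i\<close> cells.\<close>

lemma hook_length_first_column:
  assumes "\<forall>x\<in>set lam. 0 < x" "1 \<le> i" "i \<le> length lam"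
  shows "hook_length lam i 1 = lam ! (i - 1) + (length lam - i)"
proof -
  define p where "p k = lam ! (k - 1)" for k
  have pos: "1 \<le> p k" if "1 \<le> k" "k \<le> length lam" for k
    using assms(1) that by (simp add: p_def Suc_le_eq)
  have "hook lam i 1 = {i} \<times> {1..p i} \<union> {i<..length lam} \<times> {1}"
  proof (rule set_eqI)
    fix z :: "nat \<times> nat"
    obtain k l where z: "z = (k, l)" by fastforce
    have "z \<in> hook lam i 1 \<longleftrightarrow> 1 \<le> k \<and> k \<le> length lam \<and> 1 \<le> l \<and> l \<le> p k
        \<and> (k = i \<and> l \<ge> 1 \<or> l = 1 \<and> k \<ge> i)"
      by (simp add: z hook_def ferrers_def p_def)
    also have "\<dots> \<longleftrightarrow> z \<in> {i} \<times> {1..p i} \<union> {i<..length lam} \<times> {1}"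
      using assms(2,3) pos[of k] by (cases "k = i") (auto simp: z)
    finally show "z \<in> hook lam i 1 \<longleftrightarrow> z \<in> {i} \<times> {1..p i} \<union> {i<..length lam} \<times> {1}" .
  qed
  moreover have "({i} \<times> {1..p i}) \<inter> ({i<..length lam} \<times> {1}) = {}"
    by auto
  ultimately show ?thesis
    by (simp add: hook_length_def card_Un_disjoint p_def)
qed

section \<open>Adding and removing the first column\<close>

text \<open>The new column has height \<open>g\<close> only if \<open>length nu \<le> g\<close>;
  otherwise the difference truncates to 0 and nothing is appended.\<close>

definition add_column :: "nat \<Rightarrow> nat list \<Rightarrow> nat list" where
  "add_column g nu = map Suc nu @ replicate (g - length nu) 1"

definition remove_column :: "nat list \<Rightarrow> nat list" where
  "remove_column lam = filter (\<lambda>x. 0 < x) (map (\<lambda>x. x - 1) lam)"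

lemma remove_add_column:
  assumes "\<forall>x\<in>set nu. 0 < x"
  shows "remove_column (add_column g nu) = nu"
  using assms by (simp add: remove_column_def add_column_def comp_def)

lemma length_remove_column_le: "length (remove_column lam) \<le> length lam"
  by (metis length_filter_le length_map remove_column_def)

text \<open>In a nonincreasing list the parts equal to 1 form a final segment. Exactly these vanish
  with the column, so padding with ones at the end restores them in place.\<close>

lemma add_remove_column:
  assumes "sorted_wrt (\<ge>) lam" "\<forall>x\<in>set lam. 0 < x"
  shows "add_column (length lam) (remove_column lam) = lam"
  using assms
proof (induction lam)
  case Nil
  then show ?case by (simp add: add_column_def remove_column_def)
next
  case (Cons x xs)
  show ?case
  proof (cases "x = 1")
    case True
    then have "\<forall>y\<in>set xs. y = 1"
      using Cons.prems by (auto simp: le_Suc_eq)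
    then have "xs = replicate (length xs) 1"
      by (simp add: replicate_eqI)
    then obtain k where "xs = replicate k 1" by blast
    then show ?thesis
      using True by (simp add: add_column_def remove_column_def)
  next
    case False
    then have "remove_column (x # xs) = (x - 1) # remove_column xs" "Suc (x - 1) = x"
      using Cons.prems by (auto simp: remove_column_def)
    then show ?thesis
      using Cons by (simp add: add_column_def)
  qed
qed

lemma length_partition_le: "is_partition n nu \<Longrightarrow> length nu \<le> n"
proof -
  have "length nu \<le> sum_list nu" if "\<forall>x\<in>set nu. 0 < x" for nu :: "nat list"
    using that by (induction nu) (auto simp: Suc_le_eq)
  then show "is_partition n nu \<Longrightarrow> length nu \<le> n"
    by (auto simp: is_partition_def)
qed

lemma sum_list_map_Suc: "sum_list (map Suc xs) = sum_list xs + length xs"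
  by (induction xs) auto

lemma sorted_wrt_ge_replicate: "sorted_wrt (\<ge>) (replicate k (x::nat))"
  by (induction k) auto

lemma is_partition_add_column:
  assumes "is_partition n nu" "n \<le> g"
  shows "is_partition (n + g) (add_column g nu)" "length (add_column g nu) = g"
proof -
  show "is_partition (n + g) (add_column g nu)"
    using assms length_partition_le[OF assms(1)]
    by (auto simp: is_partition_def add_column_def sorted_wrt_append sorted_wrt_map
        sum_list_map_Suc sum_list_replicate sorted_wrt_ge_replicate)
  show "length (add_column g nu) = g"
    using assms(2) length_partition_le[OF assms(1)] by (simp add: add_column_def)
qed

lemma is_partition_remove_column:
  assumes "is_partition (n + length lam) lam"
  shows "is_partition n (remove_column lam)"
proof -
  \<comment> \<open>By this identity \<open>map Suc (remove_column lam)\<close> is a prefix of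
    \<open>lam\<close>, so order and sum can be read off from \<open>lam\<close>.\<close>
  have lam: "add_column (length lam) (remove_column lam) = lam"
    using assms add_remove_column by (simp add: is_partition_def)
  have "sorted_wrt (\<ge>) (map Suc (remove_column lam))"
    using assms lam by (metis add_column_def is_partition_def sorted_wrt_append)
  moreover have "sum_list lam = sum_list (remove_column lam) + length lam"
    by (subst lam[symmetric])
      (simp add: add_column_def sum_list_map_Suc sum_list_replicate length_remove_column_le)
  ultimately show ?thesis
    using assms by (auto simp: is_partition_def sorted_wrt_map remove_column_def)
qed

text \<open>A partition of \<open>n\<close> has at most \<open>n \<le> g\<close> parts, so a column
  of height \<open>g\<close> fits in front of each of them and the two column operations are
  mutually inverse.\<close>

lemma PG_eq_card_add_column:
  assumes "n \<le> g"
  shows "PG (n + g) g = card {nu. is_partition n nu \<and> numerical_semigroup (S_of (add_column g nu))}"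
proof -
  have "bij_betw (add_column g)
      {nu. is_partition n nu \<and> numerical_semigroup (S_of (add_column g nu))}
      {lam. is_partition (n + g) lam \<and> length lam = g \<and> numerical_semigroup (S_of lam)}"
  proof (rule bij_betw_byWitness[where f' = remove_column])
    show "\<forall>nu\<in>{nu. is_partition n nu \<and> numerical_semigroup (S_of (add_column g nu))}.
        remove_column (add_column g nu) = nu"
      by (auto simp: is_partition_def intro: remove_add_column)
    show "\<forall>lam\<in>{lam. is_partition (n + g) lam \<and> length lam = g \<and> numerical_semigroup (S_of lam)}.
        add_column g (remove_column lam) = lam"
      by (auto simp: is_partition_def intro: add_remove_column)
    then show "remove_column `
        {lam. is_partition (n + g) lam \<and> length lam = g \<and> numerical_semigroup (S_of lam)}
        \<subseteq> {nu. is_partition n nu \<and> numerical_semigroup (S_of (add_column g nu))}"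
      by (auto intro: is_partition_remove_column)
  qed (use assms in \<open>auto simp: is_partition_add_column\<close>)
  then show ?thesis
    by (simp add: PG_def bij_betw_same_card)
qed

section \<open>The numerical set after adding a column\<close>

text \<open>The rows of length 1 below \<open>nu\<close> contribute the initial interval of gaps.
  With \<open>i\<close> counted from 0, row \<open>i\<close> of \<open>nu\<close> gains one cell and
  has \<open>g - Suc i\<close> rows below it, hence the gap \<open>nu ! i + (g - i)\<close>.\<close>

lemma S_of_add_column:
  assumes "length nu \<le> g"
  shows "S_of (add_column g nu)
    = - ({1..g - length nu} \<union> (\<lambda>i. nu ! i + (g - i)) ` {..<length nu})"
proof -
  let ?lam = "add_column g nu"
  have len: "length ?lam = g"
    using assms by (simp add: add_column_def)
  have "hook_length ?lam (Suc i) 1 = (if i < length nu then nu ! i + (g - i) else g - i)"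
    if "i < g" for i
  proof -
    have "\<forall>x\<in>set ?lam. 0 < x"
      by (auto simp: add_column_def)
    then have "hook_length ?lam (Suc i) 1 = ?lam ! i + (g - Suc i)"
      using hook_length_first_column[of ?lam "Suc i"] len that by simp
    then show ?thesis
      using that assms by (auto simp: add_column_def nth_append)
  qed
  moreover have "{hook_length ?lam i 1 | i. 1 \<le> i \<and> i \<le> length ?lam}
      = (\<lambda>i. hook_length ?lam (Suc i) 1) ` {..<g}"
    using len by (auto simp: image_iff) (metis Suc_le_D less_eq_Suc_le lessThan_iff)
  ultimately have "{hook_length ?lam i 1 | i. 1 \<le> i \<and> i \<le> length ?lam}
      = (\<lambda>i. if i < length nu then nu ! i + (g - i) else g - i) ` {..<g}"
    by simp
  also have "{..<g} = {..<length nu} \<union> {length nu..<g}"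
    using assms by auto
  also have "(\<lambda>i. if i < length nu then nu ! i + (g - i) else g - i) ` \<dots>
      = (\<lambda>i. nu ! i + (g - i)) ` {..<length nu} \<union> (\<lambda>i. g - i) ` {length nu..<g}"
    by (auto simp: image_Un)
  also have "(\<lambda>i. g - i) ` {length nu..<g} = {1..g - length nu}"
  proof
    show "{1..g - length nu} \<subseteq> (\<lambda>i. g - i) ` {length nu..<g}"
    proof
      fix x assume "x \<in> {1..g - length nu}"
      then have "x = g - (g - x)" "g - x \<in> {length nu..<g}" by auto
      then show "x \<in> (\<lambda>i. g - i) ` {length nu..<g}" by blast
    qed
  qed auto
  finally show ?thesis
    by (auto simp: S_of_def)
qed

lemma numerical_set_S_of: "(\<forall>x\<in>set lam. 0 < x) \<Longrightarrow> numerical_set (S_of lam)"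
proof -
  assume pos: "\<forall>x\<in>set lam. 0 < x"
  have "- S_of lam = (\<lambda>i. hook_length lam i 1) ` {1..length lam}"
    by (auto simp: S_of_def)
  moreover have "hook_length lam i 1 \<noteq> 0" if "1 \<le> i" "i \<le> length lam" for i
  proof -
    have "0 < lam ! (i - 1)" using pos that by simp
    then show ?thesis using hook_length_first_column[OF pos that] by linarith
  qed
  ultimately show ?thesis
    unfolding numerical_set_def by (fastforce simp: S_of_def)
qed

text \<open>The last hypothesis is \<open>2 m > F\<close> rearranged, with
  \<open>m = g - length nu + 1\<close> and \<open>F = hd nu + g\<close>: a sum of two nonzero
  elements lies beyond every gap.\<close>

lemma numerical_semigroup_add_columnI:
  assumes "is_partition n nu" "length nu \<le> g" "nu \<noteq> []" "2 * length nu + hd nu < g + 2"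
  shows "numerical_semigroup (S_of (add_column g nu))"
  unfolding numerical_semigroup_def
proof (intro conjI ballI)
  show "numerical_set (S_of (add_column g nu))"
    by (rule numerical_set_S_of) (auto simp: add_column_def)
  fix x y assume xy: "x \<in> S_of (add_column g nu)" "y \<in> S_of (add_column g nu)"
  show "x + y \<in> S_of (add_column g nu)"
  proof (cases "x = 0 \<or> y = 0")
    case False
    then have "x \<ge> g - length nu + 1" "y \<ge> g - length nu + 1"
      using xy assms(2) by (auto simp: S_of_add_column)
    then have large: "x + y > hd nu + g"
      using assms(2,4) by linarith
    have "nu ! i \<le> hd nu" if "i < length nu" for i
      using assms(1,3) that
      by (cases i) (auto simp: is_partition_def hd_conv_nth sorted_wrt_iff_nth_less)
    then have "nu ! i + (g - i) \<noteq> x + y" if "i < length nu" for i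
      using large that by (metis add_le_mono diff_le_self leD)
    moreover have "x + y > g - length nu"
      using large by linarith
    ultimately show ?thesis
      unfolding S_of_add_column[OF assms(2)] by fastforce
  qed (use xy in auto)
qed

section \<open>Hook shapes as the only possible exceptions\<close>

text \<open>Every part of \<open>xs\<close> is at least 1, so its sum is at least its length, with
  equality only if all parts are 1.\<close>

lemma partition_hook_shape:
  assumes "is_partition n (a # xs)"
  shows "a + length xs \<le> n" "n \<le> a + length xs \<Longrightarrow> xs = replicate (n - a) 1"
proof -
  have "length xs \<le> sum_list xs" "sum_list xs \<le> length xs \<Longrightarrow> xs = replicate (length xs) 1"
    if "\<forall>x\<in>set xs. 0 < x" for xs :: "nat list"
    using that by (induction xs) (auto simp: Suc_le_eq)
  note * = this[of xs]
  show "a + length xs \<le> n" using * assms by (auto simp: is_partition_def)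
  show "xs = replicate (n - a) 1" if "n \<le> a + length xs"
  proof -
    have "sum_list xs = n - a" "length xs = n - a"
      using assms that * by (auto simp: is_partition_def)
    then show ?thesis using * assms by (auto simp: is_partition_def)
  qed
qed

lemma partition_hd_1:
  assumes "is_partition n (1 # xs)"
  shows "xs = replicate (n - 1) 1"
proof -
  have "\<forall>x\<in>set xs. x = 1"
    using assms by (auto simp: is_partition_def le_Suc_eq)
  then have "xs = replicate (length xs) 1"
    by (simp add: replicate_eqI)
  then obtain k where "xs = replicate k 1" by blast
  then show ?thesis
    using assms by (auto simp: is_partition_def sum_list_replicate)
qed

lemma not_semigroup_imp_hook:
  assumes "is_partition n nu" "n \<ge> 3" "2 * n - 3 \<le> g"
    and "\<not> numerical_semigroup (S_of (add_column g nu))"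
  obtains a where "nu = a # replicate (n - a) 1" "1 \<le> a" "a \<le> n" "a + g \<le> 2 * n"
proof (cases nu)
  case Nil
  then show ?thesis using assms by (simp add: is_partition_def)
next
  case (Cons a xs)
  note part = assms(1)[unfolded Cons]
  have a: "1 \<le> a" using part by (auto simp: is_partition_def)
  have len: "length nu \<le> g" using length_partition_le[OF assms(1)] assms(2,3) by linarith
  have ge: "g \<le> 2 * length xs + a"
    using numerical_semigroup_add_columnI[OF assms(1) len] assms(4) Cons by fastforce
  have le: "a + length xs \<le> n" using partition_hook_shape(1)[OF part] .
  have xs: "xs = replicate (n - a) 1"
  proof (cases "a = 1")
    case True
    then show ?thesis using partition_hd_1 part by simp
  next
    case False
    \<comment> \<open>Adding \<open>a\<close> to \<open>ge\<close> gives
      \<open>2 * (a + length xs) \<ge> g + a \<ge> 2 * n - 1\<close>, and parity improves this to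
      \<open>n \<le> a + length xs\<close>. For \<open>a = 1\<close> the bound is too weak, but
      there all parts are 1 anyway.\<close>
    then have "2 \<le> a" using a by linarith
    moreover have "2 * n \<le> g + 3" using assms(3) by linarith
    ultimately have "n \<le> a + length xs"
      using ge by linarith
    then show ?thesis
      using partition_hook_shape(2)[OF part] by blast
  qed
  then have "length xs = n - a" by simp
  \<comment> \<open>Substituting \<open>length xs = n - a\<close> into \<open>ge\<close> yields
    \<open>a + g \<le> 2 * n\<close>.\<close>
  then show ?thesis
    using that[of a] Cons xs a le ge by simp
qed

text \<open>The three groups of gaps come from the rows of length 1, the \<open>b\<close> rows of
  length 2 and the first row. The first two groups miss exactly \<open>g - b\<close> in
  \<open>{1..g}\<close>.\<close>

lemma S_of_add_column_hook:
  assumes "b < g"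
  shows "S_of (add_column g (a # replicate b 1))
    = - ({1..<g - b} \<union> {g - b<..g} \<union> {a + g})"
proof -
  have "(\<lambda>i. (a # replicate b 1) ! i + (g - i)) ` {..<Suc b} = {g - b<..g} \<union> {a + g}"
  proof -
    have "(\<lambda>i. (a # replicate b 1) ! i + (g - i)) ` {..<Suc b}
        = insert (a + g) ((\<lambda>i. 1 + (g - Suc i)) ` {..<b})"
      unfolding lessThan_Suc_eq_insert_0 by (auto simp: image_iff)
    also have "(\<lambda>i. 1 + (g - Suc i)) ` {..<b} = {g - b<..g}"
    proof
      show "{g - b<..g} \<subseteq> (\<lambda>i. 1 + (g - Suc i)) ` {..<b}"
      proof
        fix x assume "x \<in> {g - b<..g}"
        then have "x = 1 + (g - Suc (g - x))" "g - x \<in> {..<b}" by auto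
        then show "x \<in> (\<lambda>i. 1 + (g - Suc i)) ` {..<b}" by blast
      qed
    qed (use assms in auto)
    finally show ?thesis by simp
  qed
  moreover have "{1..g - Suc b} = {1..<g - b}"
    using assms by auto
  ultimately show ?thesis
    using assms by (simp add: S_of_add_column)
qed

text \<open>The element \<open>m = g - b\<close> has a gap as its double: if
  \<open>g \<le> 2 * b\<close> then \<open>2 * m\<close> lies in \<open>{g - b<..g}\<close>, and if
  \<open>g = a + 2 * b\<close> then \<open>2 * m = a + g\<close>.\<close>

lemma not_semigroup_hook:
  assumes "b < g" "g \<le> 2 * b \<or> g = a + 2 * b"
  shows "\<not> numerical_semigroup (S_of (add_column g (a # replicate b 1)))"
proof
  assume sg: "numerical_semigroup (S_of (add_column g (a # replicate b 1)))"
  note S = S_of_add_column_hook[OF assms(1), of a]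
  have "g - b \<in> S_of (add_column g (a # replicate b 1))"
    unfolding S using assms by auto
  then have "(g - b) + (g - b) \<in> S_of (add_column g (a # replicate b 1))"
    using sg by (simp add: numerical_semigroup_def)
  then show False
    unfolding S using assms by auto
qed

text \<open>The criterion \<open>2 m > F\<close> fails here, yet the set is closed:
  \<open>m = n - 1\<close> and \<open>2 * m = g + 1\<close> falls between the gaps \<open>g\<close>
  and \<open>F = g + 2\<close>, while \<open>3 * m > F\<close> because
  \<open>n \<ge> 3\<close>.\<close>

lemma semigroup_hook_2:
  assumes "n \<ge> 3"
  shows "numerical_semigroup (S_of (add_column (2 * n - 3) (2 # replicate (n - 2) 1)))"
    (is "numerical_semigroup ?S")
proof -
  obtain k where k: "n = k + 3"
    using assms by (metis add.commute le_Suc_ex)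
  have "?S = - ({1..<k + 2} \<union> {k + 2<..2 * k + 3} \<union> {2 * k + 5})"
    using S_of_add_column_hook[of "k + 1" "2 * k + 3" 2] by (simp add: k add.commute)
  also have "\<dots> = {0, k + 2, 2 * k + 4} \<union> {2 * k + 6..}"
    by auto
  finally have S: "?S = {0, k + 2, 2 * k + 4} \<union> {2 * k + 6..}" .
  have "numerical_set ?S"
    by (rule numerical_set_S_of) (auto simp: add_column_def)
  moreover have "\<forall>x\<in>?S. \<forall>y\<in>?S. x + y \<in> ?S"
    unfolding S by auto
  ultimately show ?thesis
    by (simp add: numerical_semigroup_def)
qed

lemma is_partition_hook:
  assumes "1 \<le> a" "a \<le> n"
  shows "is_partition n (a # replicate (n - a) 1)"
  using assms by (auto simp: is_partition_def sum_list_replicate sorted_wrt_ge_replicate)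

section \<open>Counting the exceptions\<close>

text \<open>\<open>A\<close> collects the first parts of the failing hook shapes. Since a hook shape
  of size \<open>n\<close> is determined by its first part, \<open>card A\<close> partitions are
  lost.\<close>

lemma PG_eq_num_partitions_minus:
  assumes "n \<ge> 3" "2 * n - 3 \<le> g"
    and "\<And>a. 1 \<le> a \<Longrightarrow> a \<le> n \<Longrightarrow> a + g \<le> 2 * n \<Longrightarrow>
      \<not> numerical_semigroup (S_of (add_column g (a # replicate (n - a) 1))) \<longleftrightarrow> a \<in> A"
    and "A \<subseteq> {1..n}" "\<And>a. a \<in> A \<Longrightarrow> a + g \<le> 2 * n"
  shows "int (PG (n + g) g) = int (num_partitions n) - int (card A)"
proof -
  let ?P = "{nu. is_partition n nu}" and ?h = "\<lambda>a. a # replicate (n - a) 1"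
  have "{nu. is_partition n nu \<and> numerical_semigroup (S_of (add_column g nu))} = ?P - ?h ` A"
  proof (intro set_eqI iffI)
    fix nu assume nu: "nu \<in> {nu. is_partition n nu \<and> numerical_semigroup (S_of (add_column g nu))}"
    have "nu \<notin> ?h ` A"
    proof
      assume "nu \<in> ?h ` A"
      then obtain a where "a \<in> A" "nu = ?h a" by blast
      then show False
        using nu assms(3)[of a] assms(4) assms(5)[of a] by auto
    qed
    then show "nu \<in> ?P - ?h ` A" using nu by blast
  next
    fix nu assume nu: "nu \<in> ?P - ?h ` A"
    have "numerical_semigroup (S_of (add_column g nu))"
    proof (rule ccontr)
      assume bad: "\<not> numerical_semigroup (S_of (add_column g nu))"
      with nu obtain a where "nu = ?h a" "1 \<le> a" "a \<le> n" "a + g \<le> 2 * n"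
        using not_semigroup_imp_hook[OF _ assms(1,2)] by blast
      then show False
        using nu bad assms(3)[of a] by blast
    qed
    then show "nu \<in> {nu. is_partition n nu \<and> numerical_semigroup (S_of (add_column g nu))}"
      using nu by blast
  qed
  moreover have sub: "?h ` A \<subseteq> ?P"
  proof (rule image_subsetI)
    fix a assume "a \<in> A"
    then have "1 \<le> a" "a \<le> n" using assms(4) by auto
    then show "?h a \<in> ?P" using is_partition_hook by blast
  qed
  moreover have "inj_on ?h A"
    by (auto simp: inj_on_def)
  moreover have "finite A"
    using assms(4) finite_subset by blast
  \<comment> \<open>This ensures that the difference of cardinalities does not truncate and passes
    to the integers.\<close>
  moreover have "card (?h ` A) \<le> card ?P"
    by (rule card_mono[OF finite_partitions sub])
  ultimately show ?thesis
    using assms(1,2)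
    by (simp add: PG_eq_card_add_column num_partitions_def card_Diff_subset card_image of_nat_diff)
qed

theorem theorem3p2:
  fixes n :: nat
  assumes "n \<ge> 3"
  shows "int (PG (3 * n - 1) (2 * n - 1)) = int (num_partitions n) - 1
    \<and> int (PG (3 * n - 2) (2 * n - 2)) = int (num_partitions n) - 2
    \<and> int (PG (3 * n - 3) (2 * n - 3)) = int (num_partitions n) - 2"
proof (intro conjI)
  \<comment> \<open>Only \<open>a = 1\<close> is left; with \<open>b = n - a\<close> it satisfies
    \<open>g = a + 2 * b\<close>.\<close>
  have "int (PG (n + (2 * n - 1)) (2 * n - 1)) = int (num_partitions n) - int (card {1::nat})"
  proof (rule PG_eq_num_partitions_minus)
    fix a assume "1 \<le> a" "a \<le> n" "a + (2 * n - 1) \<le> 2 * n"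
    then have a: "a = 1" using assms by linarith
    have "\<not> numerical_semigroup (S_of (add_column (2 * n - 1) (a # replicate (n - a) 1)))"
      by (rule not_semigroup_hook) (use a assms in linarith)+
    with a show "\<not> numerical_semigroup (S_of (add_column (2 * n - 1) (a # replicate (n - a) 1)))
        \<longleftrightarrow> a \<in> {1}"
      by blast
  qed (use assms in auto)
  then show "int (PG (3 * n - 1) (2 * n - 1)) = int (num_partitions n) - 1"
    using assms by (simp add: numeral_3_eq_3)
  \<comment> \<open>Here \<open>a = 1\<close> gives \<open>g = 2 * b\<close> and
    \<open>a = 2\<close> gives \<open>g = a + 2 * b\<close>, so both fail.\<close>
  have "int (PG (n + (2 * n - 2)) (2 * n - 2)) = int (num_partitions n) - int (card {1::nat, 2})"
  proof (rule PG_eq_num_partitions_minus)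
    fix a assume "1 \<le> a" "a \<le> n" "a + (2 * n - 2) \<le> 2 * n"
    then have a: "a = 1 \<or> a = 2" using assms by linarith
    have "\<not> numerical_semigroup (S_of (add_column (2 * n - 2) (a # replicate (n - a) 1)))"
      by (rule not_semigroup_hook) (use a assms in linarith)+
    with a show "\<not> numerical_semigroup (S_of (add_column (2 * n - 2) (a # replicate (n - a) 1)))
        \<longleftrightarrow> a \<in> {1, 2}"
      by blast
  qed (use assms in auto)
  then show "int (PG (3 * n - 2) (2 * n - 2)) = int (num_partitions n) - 2"
    using assms by simp
  \<comment> \<open>Here \<open>a = 1\<close> gives \<open>g < 2 * b\<close> and
    \<open>a = 3\<close> gives \<open>g = a + 2 * b\<close>, whereas \<open>a = 2\<close> survives,
    so the count is again 2.\<close>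
  have "int (PG (n + (2 * n - 3)) (2 * n - 3)) = int (num_partitions n) - int (card {1::nat, 3})"
  proof (rule PG_eq_num_partitions_minus)
    fix a assume "1 \<le> a" "a \<le> n" "a + (2 * n - 3) \<le> 2 * n"
    then consider "a = 2" | "a = 1 \<or> a = 3" using assms by linarith
    then show "\<not> numerical_semigroup (S_of (add_column (2 * n - 3) (a # replicate (n - a) 1)))
        \<longleftrightarrow> a \<in> {1, 3}"
    proof cases
      case 1
      then show ?thesis using semigroup_hook_2[OF assms] by simp
    next
      case 2
      have "\<not> numerical_semigroup (S_of (add_column (2 * n - 3) (a # replicate (n - a) 1)))"
        by (rule not_semigroup_hook) (use 2 \<open>a \<le> n\<close> assms in linarith)+
      with 2 show ?thesis by blast
    qed
  qed (use assms in auto)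
  then show "int (PG (3 * n - 3) (2 * n - 3)) = int (num_partitions n) - 2"
    using assms by simp
qed

end
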